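(* Let $\chi$ be a probability distribution with constant (finite, independent of $n$ and $m$) support, and for $n\in\mathbb{N}$ let $\mathcal{D}=\chi^n$ be the product distribution. Let $0<c<1$ be a constant, let $(k_1,\dots,k_m)\leftarrow\mathcal{D}^m$ (i.e. $k_1,\dots,k_m$ are sampled independently from $\mathcal{D}$), and consider the multi-key guessing instance $(\mathcal{D},\mathbb{1}_{k_1},\dots,\mathbb{1}_{k_m})$ with parameter $c$. (1) If $c<\frac12$, then with probability at least $1-e^{-\Omega(m)}$ the algorithm QuantumMultiKeyGuess solves the instance with amortized cost per key $$T_{\mathsf{QMKG}}=\widetilde{\mathcal{O}}\left(2^{\frac{\mathrm{H}(\chi)n}{2}}\right).$$ (2) If $\frac12\le c<1$, then with probability at least $1-e^{-\Omega(m)}$ the algorithm QuantumMultiKeyGuess solves the instance with amortized cost per key at most $2^{\frac{\mathrm{H}(\chi)n}{2}+\mathcal{O}(\sqrt n)}$, i.e. the cost increases at most by a subexponential factor $2^{\mathcal{O}(\sqrt n)}$. Here the constants hidden in $\Omega(\cdot)$, $\mathcal{O}(\cdot)$ and $\widetilde{\mathcal{O}}(\cdot)$ depend only on $\chi$ and $c$, and $\widetilde{\mathcal{O}}$ suppresses factors polynomial in $n$.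
   Context: All logarithms are base 2. For a discrete distribution $\chi$ with support $A$ and probability mass function $P_\chi$, $\mathrm{H}(\chi)=-\sum_{a\in A}P_\chi(a)\log P_\chi(a)$ is the Shannon entropy. The product distribution $\chi^n$ on $A^n$ has mass function $P_{\chi^n}(a_1,\dots,a_n)=\prod_iP_\chi(a_i)$. For a key $k$ in the key space $\mathcal{K}$ (the support of $\mathcal{D}$), $\mathbb{1}_k:\mathcal{K}\to\{0,1\}$ is the oracle with $\mathbb{1}_k(x)=1$ iff $x=k$. Multi-key guessing problem with parameter $c$: given a description of $\mathcal{D}$ and oracle access to $\mathbb{1}_{k_1},\dots,\mathbb{1}_{k_m}$ for $(k_1,\dots,k_m)\leftarrow\mathcal{D}^m$, find a tuple $(k_1',\dots,k_m')\in(\mathcal{K}\cup\{\bot\})^m$ such that $k_i'=k_i$ for at least $cm$ indices $i$. Black-box access is assumed to an algorithm GetKey$_{\mathcal{D}}$ that on input $i\in\{1,\dots,|\mathcal{K}|\}$ outputs the $i$-th most likely key of $\mathcal{D}$ (ties broken by some fixed order). Grover's algorithm (exact version, used as a known black box): given a uniform superposition over a finite set $S$ and oracle access to $\tau:S\to\{0,1\}$ with $\tau(x)=1$ for at most one $x\in S$, it outputs the $x\in S$ with $\tau(x)=1$ if it exists and $\bot$ otherwise, using $\lceil\frac{\pi}{4}\sqrt{|S|}\rceil+1$ queries to $\tau$. Algorithm QuantumMultiKeyGuess: start with $(k_1',\dots,k_m')=(\bot,\dots,\bot)$ and $t=1$. Repeat: set $t\leftarrow2t$; for each $j\in\{1,\dots,m\}$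 run Grover's algorithm on the uniform superposition $\frac{1}{\sqrt t}\sum_{i=1}^t|i\rangle$ with oracle $i\mapsto\mathbb{1}_{k_j}(\text{GetKey}_{\mathcal{D}}(i))$ (taken to be $0$ for $i>|\mathcal{K}|$), and if the result $i$ is not $\bot$ set $k_j'\leftarrow\text{GetKey}_{\mathcal{D}}(i)$; until $k_j'\ne\bot$ for at least $cm$ indices $j$. Output $(k_1',\dots,k_m')$. The cost of the algorithm is its total number of oracle queries made by the Grover runs, and the amortized cost per key $T_{\mathsf{QMKG}}$ is this total divided by $m$. The probability is over the choice of $k_1,\dots,k_m$. *)

theory Defs
  imports "HOL-Probability.Probability" "HOL-Library.While_Combinator"
begin

definition shannon_entropy :: "'a pmf \<Rightarrow> real" where
  "shannon_entropy chi = - (\<Sum>a\<in>set_pmf chi. pmf chi a * log 2 (pmf chi a))"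

text \<open>An \<open>n\<close>-tuple is a function on \<open>{1..n}\<close>, padded with \<^const>\<open>undefined\<close> outside.\<close>

definition power_pmf :: "'a pmf \<Rightarrow> nat \<Rightarrow> (nat \<Rightarrow> 'a) pmf" where
  "power_pmf chi n = Pi_pmf {1..n} undefined (\<lambda>_. chi)"

definition key_oracle :: "'k \<Rightarrow> 'k \<Rightarrow> bool" where
  "key_oracle k x \<longleftrightarrow> x = k"

text \<open>The order in which ties are broken is left open: every enumeration of the support
  by non-increasing probability qualifies.\<close>

definition is_get_key :: "'k pmf \<Rightarrow> (nat \<Rightarrow> 'k) \<Rightarrow> bool" where
  "is_get_key D get_key \<longleftrightarrow>
     bij_betw get_key {1..card (set_pmf D)} (set_pmf D) \<and>
     (\<forall>i j. 1 \<le> i \<and> i \<le> j \<and> j \<le> card (set_pmf D) \<longrightarrow> pmf D (get_key j) \<le> pmf D (get_key i))"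

text \<open>Exact Grover search enters only through its input/output behaviour and its number of
  queries; the result is meaningful if \<open>\<tau>\<close> marks at most one element of \<open>S\<close>.
  \<^const>\<open>None\<close> stands for \<open>\<bottom>\<close>.\<close>

definition grover_output :: "'x set \<Rightarrow> ('x \<Rightarrow> bool) \<Rightarrow> 'x option" where
  "grover_output S \<tau> =
     (if \<exists>x\<in>S. \<tau> x then Some (THE x. x \<in> S \<and> \<tau> x) else None)"

definition grover_queries :: "'x set \<Rightarrow> nat" where
  "grover_queries S = nat \<lceil>pi / 4 * sqrt (real (card S))\<rceil> + 1"

text \<open>\<open>total_queries\<close> counts the oracle queries of all Grover runs made so far.\<close>

record 'k qmkg_state =
  search_bound :: nat
  guesses :: "nat \<Rightarrow> 'k option"
  total_queries :: nat

definition qmkg_init :: "'k qmkg_state" where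
  "qmkg_init = \<lparr>search_bound = 1, guesses = (\<lambda>_. None), total_queries = 0\<rparr>"

definition index_oracle :: "'k pmf \<Rightarrow> (nat \<Rightarrow> 'k) \<Rightarrow> ('k \<Rightarrow> bool) \<Rightarrow> nat \<Rightarrow> bool" where
  "index_oracle D get_key orc i \<longleftrightarrow> i \<le> card (set_pmf D) \<and> orc (get_key i)"

definition qmkg_step ::
  "'k pmf \<Rightarrow> (nat \<Rightarrow> 'k) \<Rightarrow> nat \<Rightarrow> (nat \<Rightarrow> 'k \<Rightarrow> bool) \<Rightarrow> 'k qmkg_state \<Rightarrow> 'k qmkg_state" where
  "qmkg_step D get_key m orcs s =
     (let t = 2 * search_bound s in
      \<lparr>search_bound = t,
       guesses = (\<lambda>j. if j \<in> {1..m}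
          then (case grover_output {1..t} (index_oracle D get_key (orcs j)) of
                  Some i \<Rightarrow> Some (get_key i)
                | None \<Rightarrow> guesses s j)
          else guesses s j),
       total_queries = total_queries s + (\<Sum>j\<in>{1..m}. grover_queries {1..t})\<rparr>)"

definition qmkg_done :: "real \<Rightarrow> nat \<Rightarrow> 'k qmkg_state \<Rightarrow> bool" where
  "qmkg_done c m s \<longleftrightarrow> real (card {j \<in> {1..m}. guesses s j \<noteq> None}) \<ge> c * real m"

text \<open>A repeat-until loop, hence one step before the first test. The result is \<^const>\<open>None\<close>
  if the loop does not terminate.\<close>

definition quantum_multi_key_guess ::
  "'k pmf \<Rightarrow> (nat \<Rightarrow> 'k) \<Rightarrow> real \<Rightarrow> nat \<Rightarrow> (nat \<Rightarrow> 'k \<Rightarrow> bool) \<Rightarrow> 'k qmkg_state option" where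
  "quantum_multi_key_guess D get_key c m orcs =
     while_option (\<lambda>s. \<not> qmkg_done c m s) (qmkg_step D get_key m orcs)
       (qmkg_step D get_key m orcs qmkg_init)"

definition multi_key_solution ::
  "'k pmf \<Rightarrow> real \<Rightarrow> nat \<Rightarrow> (nat \<Rightarrow> 'k) \<Rightarrow> (nat \<Rightarrow> 'k option) \<Rightarrow> bool" where
  "multi_key_solution D c m k k' \<longleftrightarrow>
     (\<forall>j\<in>{1..m}. k' j \<in> insert None (Some ` set_pmf D)) \<and>
     real (card {j \<in> {1..m}. k' j = Some (k j)}) \<ge> c * real m"

definition qmkg_solves_within ::
  "'k pmf \<Rightarrow> (nat \<Rightarrow> 'k) \<Rightarrow> real \<Rightarrow> nat \<Rightarrow> real \<Rightarrow> (nat \<Rightarrow> 'k) \<Rightarrow> bool" where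
  "qmkg_solves_within D get_key c m T k \<longleftrightarrow>
     (\<exists>s. quantum_multi_key_guess D get_key c m (\<lambda>j. key_oracle (k j)) = Some s \<and>
          multi_key_solution D c m k (guesses s) \<and>
          real (total_queries s) / real m \<le> T)"

end

(*  Every key of probability at least 1/B is among the first B keys of GetKey, so once the search
    bound reaches B each such key has been found; the query counts of the rounds form a geometric
    series, whence an amortized cost of at most 20 sqrt B. If a key has probability at least 1/B
    with probability p > c, Hoeffding's inequality over the m keys bounds the failure probability
    by exp (-2 (p - c)^2 m).

    It remains to choose B. For D = chi^n the surprisal -log P(k) is a sum of n independent
    copies of a bounded variable with mean H(chi). Hoeffding's inequality over the n coordinates
    yields log B = H(chi) n + O(sqrt n) for any p < 1. For p < 1/2 the central limit theorem gives
    log B = H(chi) n for all large n, so that even a constant suffices as the suppressed factor. *)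

theory Submission imports Defs begin

subsection \<open>Cost of the algorithm in terms of the likely keys\<close>

text \<open>Injectivity of \<open>get_key\<close> on the indices of the support leaves at most one
  marked index, so the \<open>THE\<close> in \<open>grover_output\<close> is well defined. Indices
  beyond the support are never marked, which cuts the search range at the minimum.\<close>

lemma grover_output_key_oracle:
  assumes gk: "bij_betw get_key {1..card (set_pmf D)} (set_pmf D)"
  shows "map_option get_key (grover_output {1..t} (index_oracle D get_key (key_oracle k))) =
         (if k \<in> get_key ` {1..min t (card (set_pmf D))} then Some k else None)"
proof -
  let ?\<tau> = "index_oracle D get_key (key_oracle k)"
  have marked: "(\<exists>i\<in>{1..t}. ?\<tau> i) \<longleftrightarrow> k \<in> get_key ` {1..min t (card (set_pmf D))}"
    by (auto simp: index_oracle_def key_oracle_def)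
  have "get_key (THE i. i \<in> {1..t} \<and> ?\<tau> i) = k" if "\<exists>i\<in>{1..t}. ?\<tau> i"
  proof -
    from that obtain i where i: "i \<in> {1..t}" "?\<tau> i" by blast
    have "(THE i. i \<in> {1..t} \<and> ?\<tau> i) = i"
    proof (rule the_equality)
      show "i' = i" if "i' \<in> {1..t} \<and> ?\<tau> i'" for i'
        by (rule inj_onD[OF bij_betw_imp_inj_on[OF gk]])
           (use i that in \<open>simp_all add: index_oracle_def key_oracle_def\<close>)
    qed (use i in simp)
    then show ?thesis using i by (simp add: index_oracle_def key_oracle_def)
  qed
  then show ?thesis
    unfolding marked[symmetric] grover_output_def by simp
qed

text \<open>The loop stripped of its exit test. The number of rounds becomes a free parameter, so
  that bound, cost and guesses get closed forms by induction; the output is the state at the first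
  tested round that passes.\<close>

definition qmkg_run :: "'k pmf \<Rightarrow> (nat \<Rightarrow> 'k) \<Rightarrow> nat \<Rightarrow> (nat \<Rightarrow> 'k) \<Rightarrow> nat \<Rightarrow> 'k qmkg_state" where
  "qmkg_run D get_key m k r = (qmkg_step D get_key m (\<lambda>j. key_oracle (k j)) ^^ r) qmkg_init"

lemma qmkg_run_search_bound: "search_bound (qmkg_run D get_key m k r) = 2 ^ r"
  by (induction r) (simp_all add: qmkg_run_def qmkg_init_def qmkg_step_def Let_def)

lemma qmkg_run_total_queries:
  "total_queries (qmkg_run D get_key m k r) = m * (\<Sum>i=1..r. grover_queries {1..2 ^ i :: nat})"
proof (induction r)
  case 0
  then show ?case by (simp add: qmkg_run_def qmkg_init_def)
next
  case (Suc r)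
  then show ?case
    using qmkg_run_search_bound[of D get_key m k r]
    by (simp add: qmkg_run_def qmkg_step_def Let_def algebra_simps)
qed

text \<open>The searched sets of keys grow with the round, and a repeated success writes the same
  key again, so only the last search range matters. The formula fails at \<open>r = 0\<close>: there
  all guesses are \<open>None\<close>, although its range would already contain the most likely key.
  The first actual search has range 2.\<close>

lemma qmkg_run_guesses:
  assumes gk: "bij_betw get_key {1..card (set_pmf D)} (set_pmf D)" and r: "r \<ge> 1"
  shows "guesses (qmkg_run D get_key m k r) =
    (\<lambda>j. if j \<in> {1..m} \<and> k j \<in> get_key ` {1..min (2 ^ r) (card (set_pmf D))}
         then Some (k j) else None)"
proof -
  define A where "A r = get_key ` {1..min (2 ^ r) (card (set_pmf D))}" for r
  have step: "guesses (qmkg_run D get_key m k (Suc r)) j =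
      (if j \<in> {1..m} \<and> k j \<in> A (Suc r) then Some (k j)
       else guesses (qmkg_run D get_key m k r) j)" for r j
  proof -
    have "map_option get_key (grover_output {1..2 * 2 ^ r} (index_oracle D get_key (key_oracle (k j)))) =
        (if k j \<in> A (Suc r) then Some (k j) else None)"
      unfolding grover_output_key_oracle[OF gk] A_def power_Suc ..
    moreover have "qmkg_run D get_key m k (Suc r) =
        qmkg_step D get_key m (\<lambda>j. key_oracle (k j)) (qmkg_run D get_key m k r)"
      by (simp add: qmkg_run_def)
    ultimately show ?thesis
      by (cases "grover_output {1..2 * 2 ^ r} (index_oracle D get_key (key_oracle (k j)))")
         (simp_all add: qmkg_step_def Let_def qmkg_run_search_bound split: if_splits)
  qed
  have A_mono: "A r \<subseteq> A (Suc r)" for r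
    unfolding A_def by (intro image_mono) auto
  have "guesses (qmkg_run D get_key m k r) j =
    (if j \<in> {1..m} \<and> k j \<in> A r then Some (k j) else None)" for j
    using r
  proof (induction r rule: nat_induct_at_least)
    case base
    have "guesses (qmkg_run D get_key m k 0) j = None" by (simp add: qmkg_run_def qmkg_init_def)
    then show ?case by (simp add: step)
  next
    case (Suc r)
    with A_mono[of r] show ?case by (simp only: step) auto
  qed
  then show ?thesis unfolding A_def by (rule ext)
qed

text \<open>One multiple of \<open>sqrt 2 ^ r\<close> covers the main term because pi/4 < 1. The
  ceiling and the extra query cost at most 2, which two more multiples cover since
  \<open>sqrt 2 ^ r\<close> is at least 1.4.\<close>

lemma grover_queries_le:
  assumes "r \<ge> 1"
  shows "real (grover_queries {1..2 ^ r :: nat}) \<le> 3 * sqrt 2 ^ r"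
proof -
  have "sqrt 2 ^ 1 \<le> sqrt 2 ^ r" by (rule power_increasing) (use assms in auto)
  moreover have "1.4 \<le> sqrt 2" by (rule real_le_rsqrt) (simp add: power2_eq_square)
  ultimately have s: "1.4 \<le> sqrt 2 ^ r" by simp
  have "real (grover_queries {1..2 ^ r :: nat}) =
      of_int \<lceil>pi / 4 * sqrt 2 ^ r\<rceil> + 1"
    by (simp add: grover_queries_def real_sqrt_power)
  also have "\<dots> \<le> pi / 4 * sqrt 2 ^ r + 2" by linarith
  also have "pi / 4 * sqrt 2 ^ r \<le> 1 * sqrt 2 ^ r"
    by (intro mult_right_mono) (use pi_less_4 in auto)
  finally show ?thesis using s by linarith
qed

text \<open>A geometric series is dominated by its last term. The constant 12 makes the induction
  close: 12 + 3 sqrt 2 \<le> 12 sqrt 2 holds because sqrt 2 \<ge> 4/3.\<close>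

lemma sum_grover_queries_le:
  "real (\<Sum>i=1..r. grover_queries {1..2 ^ i :: nat}) \<le> 12 * sqrt 2 ^ r"
proof (induction r)
  case (Suc r)
  have s: "1.4 \<le> sqrt 2" by (rule real_le_rsqrt) (simp add: power2_eq_square)
  have "real (\<Sum>i=1..Suc r. grover_queries {1..2 ^ i :: nat}) \<le> 12 * sqrt 2 ^ r + 3 * sqrt 2 ^ Suc r"
    using Suc grover_queries_le[of "Suc r"] by simp
  also have "\<dots> = (12 + 3 * sqrt 2) * sqrt 2 ^ r" by (simp add: algebra_simps)
  also have "\<dots> \<le> (12 * sqrt 2) * sqrt 2 ^ r"
    by (intro mult_right_mono) (use s in auto)
  finally show ?case by simp
qed simp

lemma least_power_of_two_above:
  fixes B :: real
  assumes "B \<ge> 1"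
  obtains R :: nat where "R \<ge> 1" "B \<le> 2 ^ R" "2 ^ R \<le> 2 * B"
proof -
  obtain n0 where "B < 2 ^ n0" using real_arch_pow[of 2 B] by auto
  moreover have "(2 :: real) ^ n0 \<le> 2 ^ Suc n0" by (rule power_increasing) auto
  ultimately have ex: "B \<le> 2 ^ Suc n0" by linarith
  \<comment> \<open>Minimising over exponents of the form \<open>Suc n\<close> guarantees at least
    one round. Minimality bounds the overshoot by a factor 2, and for exponent 1 this is the
    assumption B \<ge> 1.\<close>
  define n where "n = (LEAST n. B \<le> 2 ^ Suc n)"
  have up: "B \<le> 2 ^ Suc n" unfolding n_def by (rule LeastI[of _ n0]) (rule ex)
  have "2 ^ Suc n \<le> 2 * B"
  proof (cases n)
    case (Suc n')
    then have "\<not> B \<le> 2 ^ Suc n'" using not_less_Least[of n' "\<lambda>n. B \<le> 2 ^ Suc n"]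
      by (simp add: n_def)
    then show ?thesis using Suc by simp
  qed (use assms in simp)
  with up that[of "Suc n"] show ?thesis by simp
qed

text \<open>If the key has index i, then all of the first i keys have probability at least 1/B.
  Their total mass is at most 1, hence i \<le> B.\<close>

lemma likely_keys_first:
  assumes gk: "is_get_key D get_key"
    and B: "B > 0" and k: "k \<in> set_pmf D" "1 / B \<le> pmf D k"
  obtains i where "i \<in> {1..card (set_pmf D)}" "real i \<le> B" "k = get_key i"
proof -
  have bij: "bij_betw get_key {1..card (set_pmf D)} (set_pmf D)"
    and anti: "\<And>i j. 1 \<le> i \<Longrightarrow> i \<le> j \<Longrightarrow> j \<le> card (set_pmf D) \<Longrightarrow>
                 pmf D (get_key j) \<le> pmf D (get_key i)"
    using gk by (auto simp: is_get_key_def)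
  obtain i where i: "i \<in> {1..card (set_pmf D)}" "k = get_key i"
    using k bij unfolding bij_betw_def by blast
  have "real i * (1 / B) = (\<Sum>j\<in>{1..i}. 1 / B)" by simp
  also have "\<dots> \<le> (\<Sum>j\<in>{1..i}. pmf D (get_key j))"
  proof (rule sum_mono)
    fix j assume "j \<in> {1..i}"
    then show "1 / B \<le> pmf D (get_key j)" using anti[of j i] i k by auto
  qed
  also have "\<dots> = sum (pmf D) (get_key ` {1..i})"
    using bij i by (subst sum.reindex) (auto simp: bij_betw_def intro: inj_on_subset)
  also have "\<dots> = measure_pmf.prob D (get_key ` {1..i})"
    by (simp add: measure_measure_pmf_finite)
  also have "\<dots> \<le> 1" by simp
  finally have "real i \<le> B" using B by (simp add: field_simps)
  then show ?thesis using that i by blast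
qed

text \<open>By round R, with 2^R between B and 2B, every likely key has been found and the exit test
  holds. The loop may stop earlier, which only lowers the cost. The constant comes from 12 sqrt(2B)
  \<le> 12 * 1.5 * sqrt B = 18 sqrt B.\<close>

lemma qmkg_solves_within_likely:
  assumes gk: "is_get_key D get_key"
    and m: "m \<ge> 1" and B: "B \<ge> 1"
    and likely: "c * real m \<le> real (card {j\<in>{1..m}. k j \<in> set_pmf D \<and> 1 / B \<le> pmf D (k j)})"
  shows "qmkg_solves_within D get_key c m (20 * sqrt B) k"
proof -
  \<comment> \<open>One round precedes the first test, so \<open>r\<close> iterations of the while
    loop amount to \<open>Suc r\<close> rounds.\<close>
  let ?s = "\<lambda>r. qmkg_run D get_key m k (Suc r)"
  have bij: "bij_betw get_key {1..card (set_pmf D)} (set_pmf D)"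
    using gk by (auto simp: is_get_key_def)
  obtain R where R: "R \<ge> 1" "B \<le> 2 ^ R" "2 ^ R \<le> 2 * B"
    using least_power_of_two_above[OF B] .
  have "{j\<in>{1..m}. k j \<in> set_pmf D \<and> 1 / B \<le> pmf D (k j)}
      \<subseteq> {j\<in>{1..m}. guesses (?s (R - 1)) j \<noteq> None}"
  proof
    fix j assume "j \<in> {j\<in>{1..m}. k j \<in> set_pmf D \<and> 1 / B \<le> pmf D (k j)}"
    then have j: "j \<in> {1..m}" "k j \<in> set_pmf D" "1 / B \<le> pmf D (k j)" by auto
    obtain i where i: "i \<in> {1..card (set_pmf D)}" "real i \<le> B" "k j = get_key i"
      using likely_keys_first[OF gk _ j(2,3)] B by auto
    have "real i \<le> 2 ^ R" using i R by linarith
    then have "i \<le> 2 ^ R" by (rule of_nat_le_numeral_power_cancel_iff[THEN iffD1])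
    then have "k j \<in> get_key ` {1..min (2 ^ R) (card (set_pmf D))}" using i by auto
    then have "guesses (qmkg_run D get_key m k R) j = Some (k j)"
      using j(1) by (simp only: qmkg_run_guesses[OF bij R(1)] simp_thms if_True)
    then show "j \<in> {j\<in>{1..m}. guesses (?s (R - 1)) j \<noteq> None}" using j(1) R(1) by simp
  qed
  then have "card {j\<in>{1..m}. k j \<in> set_pmf D \<and> 1 / B \<le> pmf D (k j)}
      \<le> card {j\<in>{1..m}. guesses (?s (R - 1)) j \<noteq> None}"
    by (intro card_mono) auto
  with likely have done_R: "qmkg_done c m (?s (R - 1))" by (simp add: qmkg_done_def)
  \<comment> \<open>This is the iteration count that \<open>while_option\<close> itself selects;
    \<open>done_R\<close> shows that it exists and lies below \<open>R\<close>.\<close>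
  define r where "r = (LEAST r. qmkg_done c m (?s r))"
  have done_r: "qmkg_done c m (?s r)" unfolding r_def using done_R by (rule LeastI)
  have r_le: "Suc r \<le> R" using Least_le[of "\<lambda>r. qmkg_done c m (?s r)", OF done_R] R(1)
    by (simp add: r_def)
  have run: "((qmkg_step D get_key m (\<lambda>j. key_oracle (k j)) ^^ r)
      (qmkg_step D get_key m (\<lambda>j. key_oracle (k j)) qmkg_init)) = ?s r" for r
    unfolding qmkg_run_def by (simp only: funpow_Suc_right o_apply)
  have out: "quantum_multi_key_guess D get_key c m (\<lambda>j. key_oracle (k j)) = Some (?s r)"
    unfolding quantum_multi_key_guess_def while_option_def run not_not r_def[symmetric]
    by (rule if_P) (rule exI, rule done_R)
  define K where "K = get_key ` {1..min (2 ^ Suc r) (card (set_pmf D))}"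
  have guesses_r: "guesses (?s r) j = (if j \<in> {1..m} \<and> k j \<in> K then Some (k j) else None)" for j
    unfolding K_def by (subst qmkg_run_guesses[OF bij]) simp_all
  have "K \<subseteq> set_pmf D"
    using bij by (auto simp: K_def bij_betw_def)
  then have "\<forall>j\<in>{1..m}. guesses (?s r) j \<in> insert None (Some ` set_pmf D)"
    unfolding guesses_r by auto
  \<comment> \<open>A guess is never wrong, so the exit test, which only counts guesses, already
    counts correct keys.\<close>
  moreover have "{j \<in> {1..m}. guesses (?s r) j \<noteq> None} = {j \<in> {1..m}. guesses (?s r) j = Some (k j)}"
    unfolding guesses_r by auto
  then have "c * real m \<le> real (card {j \<in> {1..m}. guesses (?s r) j = Some (k j)})"
    using done_r unfolding qmkg_done_def by (simp only:)
  ultimately have sol: "multi_key_solution D c m k (guesses (?s r))"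
    unfolding multi_key_solution_def by blast
  have "real (total_queries (?s r)) / real m
      = real (\<Sum>i=1..Suc r. grover_queries {1..2 ^ i :: nat})"
    using m by (subst qmkg_run_total_queries) simp
  also have "\<dots> \<le> 12 * sqrt 2 ^ Suc r" by (rule sum_grover_queries_le)
  also have "\<dots> \<le> 12 * sqrt 2 ^ R"
    by (intro mult_left_mono power_increasing r_le) auto
  also have "\<dots> = 12 * sqrt (2 ^ R)" by (simp add: real_sqrt_power)
  also have "\<dots> \<le> 12 * sqrt (2 * B)" using R by simp
  also have "\<dots> = 12 * (sqrt 2 * sqrt B)" by (simp add: real_sqrt_mult)
  also have "\<dots> \<le> 12 * (1.5 * sqrt B)"
    using real_le_lsqrt[of "1.5" 2] B
    by (intro mult_left_mono mult_right_mono) (auto simp: power2_eq_square)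
  also have "\<dots> \<le> 20 * sqrt B" using B by simp
  finally show ?thesis using out sol unfolding qmkg_solves_within_def by blast
qed

lemma qmkg_solves_within_mono:
  "qmkg_solves_within D get_key c m T k \<Longrightarrow> T \<le> T' \<Longrightarrow> qmkg_solves_within D get_key c m T' k"
  unfolding qmkg_solves_within_def by force

subsection \<open>Concentration over the keys\<close>

text \<open>Hoeffding's inequality for the independent, identically distributed coordinates of a
  product. The lower tail is applied to the m keys, the upper tail to the n coordinates of a single
  key.\<close>

lemma Pi_pmf_sum_tail:
  fixes Y :: "'a \<Rightarrow> real" and a b \<epsilon> \<mu> :: real
  assumes I: "finite I" "I \<noteq> {}" and ab: "a < b"
    and Y: "\<And>x. x \<in> set_pmf p \<Longrightarrow> Y x \<in> {a..b}" and eps: "\<epsilon> \<ge> 0"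
  defines "\<mu> \<equiv> measure_pmf.expectation p Y"
  shows "measure_pmf.prob (Pi_pmf I dflt (\<lambda>_. p)) {x. (\<Sum>i\<in>I. Y (x i)) \<ge> card I * \<mu> + \<epsilon>}
           \<le> exp (- 2 * \<epsilon>\<^sup>2 / (card I * (b - a)\<^sup>2))"
    and "measure_pmf.prob (Pi_pmf I dflt (\<lambda>_. p)) {x. (\<Sum>i\<in>I. Y (x i)) \<le> card I * \<mu> - \<epsilon>}
           \<le> exp (- 2 * \<epsilon>\<^sup>2 / (card I * (b - a)\<^sup>2))"
proof -
  define P where "P = Pi_pmf I dflt (\<lambda>_. p)"
  have comp: "map_pmf (\<lambda>x. x i) P = p" if "i \<in> I" for i
    using that I by (simp add: P_def Pi_pmf_component)
  have mean: "measure_pmf.expectation P (\<lambda>x. Y (x i)) = \<mu>" if "i \<in> I" for i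
    unfolding \<mu>_def by (subst comp[OF that, symmetric]) simp
  interpret Hoeffding_ineq "measure_pmf P" I "\<lambda>i x. Y (x i)" "\<lambda>_. a" "\<lambda>_. b" "card I * \<mu>"
  proof unfold_locales
    show "prob_space.indep_vars P (\<lambda>_. borel) (\<lambda>i x. Y (x i)) I"
      unfolding P_def
      by (rule prob_space.indep_vars_compose2[OF measure_pmf.prob_space_axioms indep_vars_Pi_pmf]) (use I in auto)
    show "AE x in measure_pmf P. Y (x i) \<in> {a..b}" if "i \<in> I" for i
    proof (rule AE_pmfI)
      fix x assume "x \<in> set_pmf P"
      then have "x i \<in> set_pmf p" by (subst comp[OF that, symmetric]) auto
      then show "Y (x i) \<in> {a..b}" by (rule Y)
    qed
  qed (use I in \<open>simp_all add: mean\<close>)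
  have "0 < real (card I) * (b - a)\<^sup>2"
    using I ab by (simp add: card_gt_0_iff)
  then show "measure_pmf.prob (Pi_pmf I dflt (\<lambda>_. p)) {x. (\<Sum>i\<in>I. Y (x i)) \<ge> card I * \<mu> + \<epsilon>}
           \<le> exp (- 2 * \<epsilon>\<^sup>2 / (card I * (b - a)\<^sup>2))"
    and "measure_pmf.prob (Pi_pmf I dflt (\<lambda>_. p)) {x. (\<Sum>i\<in>I. Y (x i)) \<le> card I * \<mu> - \<epsilon>}
           \<le> exp (- 2 * \<epsilon>\<^sup>2 / (card I * (b - a)\<^sup>2))"
    using Hoeffding_ineq_ge[OF eps] Hoeffding_ineq_le[OF eps] by (simp_all add: P_def)
qed

lemma prob_qmkg_solves_within:
  assumes gk: "is_get_key D get_key"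
    and m: "m \<ge> 1" and B: "B \<ge> 1" and cp: "c < p"
    and likely: "p \<le> measure_pmf.prob D {x. 1 / B \<le> pmf D x}" and T: "20 * sqrt B \<le> T"
  shows "measure_pmf.prob (power_pmf D m) {k. qmkg_solves_within D get_key c m T k}
           \<ge> 1 - exp (- (2 * (p - c)\<^sup>2) * real m)"
proof -
  \<comment> \<open>Intersecting with the support loses no mass, and the indicator of
    \<open>L\<close> takes values in [0,1].\<close>
  define L where "L = {x\<in>set_pmf D. 1 / B \<le> pmf D x}"
  let ?\<mu> = "measure_pmf.expectation D (indicator L :: _ \<Rightarrow> real)"
  have "{x. 1 / B \<le> pmf D x} \<inter> set_pmf D = L" by (auto simp: L_def)
  then have mu: "p \<le> ?\<mu>"
    using likely measure_Int_set_pmf[of D "{x. 1 / B \<le> pmf D x}"] by simp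
  have sum_L: "(\<Sum>j\<in>{1..m}. indicator L (k j)) = real (card {j\<in>{1..m}. k j \<in> L})"
    for k :: "nat \<Rightarrow> 'a"
    by (simp add: indicator_def sum.If_cases) (auto intro!: arg_cong[where f = card])
  \<comment> \<open>A deviation of m(p - c) below a mean of at least mp still leaves cm likely keys
    outside this event.\<close>
  let ?bad = "{k. (\<Sum>j\<in>{1..m}. indicator L (k j)) \<le> card {1..m} * ?\<mu> - real m * (p - c)}"
  have "measure_pmf.prob (power_pmf D m) ?bad
      \<le> exp (- 2 * (real m * (p - c))\<^sup>2 / (real (card {1..m}) * (1 - 0)\<^sup>2))"
    unfolding power_pmf_def
    by (rule Pi_pmf_sum_tail) (use m cp in auto)
  also have "- 2 * (real m * (p - c))\<^sup>2 / (real (card {1..m}) * (1 - 0)\<^sup>2) = - (2 * (p - c)\<^sup>2) * real m"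
    using m by (simp add: power2_eq_square field_simps)
  finally have "1 - exp (- (2 * (p - c)\<^sup>2) * real m) \<le> 1 - measure_pmf.prob (power_pmf D m) ?bad"
    by simp
  also have "\<dots> = measure_pmf.prob (power_pmf D m) (UNIV - ?bad)"
    using measure_pmf.prob_compl[of ?bad "power_pmf D m"] by simp
  also have "\<dots> \<le> measure_pmf.prob (power_pmf D m) {k. qmkg_solves_within D get_key c m T k}"
  proof (intro measure_pmf.finite_measure_mono subsetI CollectI)
    fix k assume "k \<in> UNIV - ?bad"
    then have "real m * ?\<mu> - real m * (p - c) \<le> real (card {j\<in>{1..m}. k j \<in> L})"
      using sum_L[of k] by simp
    moreover have "real m * p \<le> real m * ?\<mu>" using mu by (intro mult_left_mono) auto
    ultimately have "c * real m \<le> real (card {j\<in>{1..m}. k j \<in> L})"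
      by (simp add: algebra_simps)
    then have "qmkg_solves_within D get_key c m (20 * sqrt B) k"
      by (intro qmkg_solves_within_likely gk m B) (simp add: L_def)
    then show "qmkg_solves_within D get_key c m T k" using T by (rule qmkg_solves_within_mono)
  qed simp
  finally show ?thesis .
qed

subsection \<open>The central limit theorem for powers of a distribution\<close>

lemma measure_std_normal_singleton_0: "measure std_normal_distribution {0} = 0"
proof -
  have "emeasure std_normal_distribution {0} = 0"
    by (subst emeasure_density) (auto simp: nn_integral_indicator_singleton)
  then show ?thesis by (simp add: measure_def)
qed

text \<open>The characteristic function is even, so by Levy uniqueness the law is invariant under
  reflection. Both closed half-lines then have equal mass, and they overlap in a null set.\<close>

lemma measure_std_normal_atMost_0: "measure std_normal_distribution {..0} = 1 / 2"
proof -
  let ?N = std_normal_distribution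
  interpret N: real_distribution ?N by (rule real_dist_normal_dist)
  have "emeasure ?N {0..} = emeasure (distr ?N borel uminus) {..0}"
    by (subst emeasure_distr) (auto intro!: arg_cong[where f = "emeasure ?N"])
  also have "distr ?N borel uminus = ?N"
  proof (rule Levy_uniqueness)
    show "real_distribution (distr ?N borel uminus)" by (rule N.real_distribution_distr) simp
    show "char (distr ?N borel uminus) = char ?N"
    proof
      fix t
      have "char (distr ?N borel uminus) t = char ?N (- t)"
        by (simp add: char_def integral_distr)
      then show "char (distr ?N borel uminus) t = char ?N t"
        by (simp add: char_std_normal_distribution)
    qed
  qed (rule real_dist_normal_dist)
  finally have eq: "measure ?N {0..} = measure ?N {..0}" by (simp add: measure_def)
  have "measure ?N UNIV = measure ?N ({..0} \<union> {0..})"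
    by (rule arg_cong[where f = "measure ?N"]) auto
  moreover have "measure ?N ({..0} \<union> {0..}) = measure ?N {..0} + measure ?N {0..} - measure ?N ({..0} \<inter> {0..})"
    by (subst N.finite_measure_Union') (auto simp: N.finite_measure_Diff' Int_commute)
  moreover have "{..0::real} \<inter> {0..} = {0}" by auto
  ultimately show ?thesis using eq N.prob_space measure_std_normal_singleton_0 by simp
qed

section \<open>From an infinite independent sequence to finite powers\<close>

context
  fixes p :: "'a pmf"
begin

abbreviation (input) "iid_seq \<equiv> Pi\<^sub>M (UNIV :: nat set) (\<lambda>_. measure_pmf p)"

lemma prob_space_iid_seq: "prob_space iid_seq"
  by (rule prob_space_PiM) (rule measure_pmf.prob_space_axioms)

lemma distr_iid_seq: "distr iid_seq (measure_pmf p) (\<lambda>\<omega>. \<omega> i) = measure_pmf p"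
  by (rule distr_PiM_component) (simp_all add: measure_pmf.prob_space_axioms)

lemma measurable_iid_seq [measurable]: "(\<lambda>\<omega>. f (\<omega> i)) \<in> borel_measurable iid_seq"
  for f :: "'a \<Rightarrow> real"
  by (rule measurable_compose[OF measurable_component_singleton]) auto

lemma distr_iid_seq_borel:
  fixes f :: "'a \<Rightarrow> real"
  shows "distr iid_seq borel (\<lambda>\<omega>. f (\<omega> i)) = distr (measure_pmf p) borel f"
  by (subst (2) distr_iid_seq[of i, symmetric], subst distr_distr) (auto simp: o_def)

lemma indep_vars_iid_seq:
  fixes f :: "'a \<Rightarrow> real"
  shows "prob_space.indep_vars iid_seq (\<lambda>_. borel) (\<lambda>i \<omega>. f (\<omega> i)) UNIV"
proof -
  interpret prob_space iid_seq by (rule prob_space_iid_seq)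
  have "indep_vars (\<lambda>_. measure_pmf p) (\<lambda>i \<omega>. \<omega> i) UNIV"
    by (subst indep_vars_iff_distr_eq_PiM') (simp_all add: distr_iid_seq restrict_def)
  then show ?thesis by (rule indep_vars_compose2) auto
qed

text \<open>The central limit theorem of the library is about a single infinite sequence of variables;
  characteristic functions transfer it to the finite powers.\<close>

lemma distr_Pi_pmf_sum:
  fixes Y :: "'a \<Rightarrow> real"
  shows "distr (measure_pmf (Pi_pmf {1..n::nat} dflt (\<lambda>_. p))) borel (\<lambda>x. \<Sum>i\<in>{1..n}. Y (x i)) =
   distr iid_seq borel (\<lambda>\<omega>. \<Sum>i<n. Y (\<omega> i))"
proof (rule Levy_uniqueness)
  let ?P = "Pi_pmf {1..n::nat} dflt (\<lambda>_. p)"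
  interpret iid: prob_space iid_seq by (rule prob_space_iid_seq)
  show "real_distribution (distr (measure_pmf ?P) borel (\<lambda>x. \<Sum>i\<in>{1..n}. Y (x i)))"
    by (rule prob_space.real_distribution_distr[OF measure_pmf.prob_space_axioms]) simp
  show "real_distribution (distr iid_seq borel (\<lambda>\<omega>. \<Sum>i<n. Y (\<omega> i)))"
    by (rule iid.real_distribution_distr) simp
  have comp: "distr (measure_pmf ?P) borel (\<lambda>x. Y (x i)) = distr (measure_pmf p) borel Y"
    if "i \<in> {1..n}" for i
  proof -
    have "map_pmf (\<lambda>x. x i) ?P = p" using that by (simp add: Pi_pmf_component)
    then have "measure_pmf p = distr (measure_pmf ?P) (count_space UNIV) (\<lambda>x. x i)"
      by (metis map_pmf_rep_eq)
    then show ?thesis by (simp add: distr_distr o_def)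
  qed
  show "char (distr (measure_pmf ?P) borel (\<lambda>x. \<Sum>i\<in>{1..n}. Y (x i))) =
        char (distr iid_seq borel (\<lambda>\<omega>. \<Sum>i<n. Y (\<omega> i)))"
  proof
    fix t
    \<comment> \<open>Both sides reduce to the n-th power of the characteristic function of
      \<open>Y\<close>, so it is harmless that one sum runs over \<open>{1..n}\<close> and the other
      over \<open>{..<n}\<close>.\<close>
    have "char (distr (measure_pmf ?P) borel (\<lambda>x. \<Sum>i\<in>{1..n}. Y (x i))) t
        = (\<Prod>i\<in>{1..n}. char (distr (measure_pmf ?P) borel (\<lambda>x. Y (x i))) t)"
      by (rule prob_space.char_distr_sum[OF measure_pmf.prob_space_axioms],
          rule prob_space.indep_vars_compose2[OF measure_pmf.prob_space_axioms indep_vars_Pi_pmf])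
         auto
    also have "\<dots> = char (distr (measure_pmf p) borel Y) t ^ n"
      using comp by simp
    also have "\<dots> = (\<Prod>i<n. char (distr iid_seq borel (\<lambda>\<omega>. Y (\<omega> i))) t)"
      by (simp add: distr_iid_seq_borel)
    also have "\<dots> = char (distr iid_seq borel (\<lambda>\<omega>. \<Sum>i<n. Y (\<omega> i))) t"
      by (rule iid.char_distr_sum[symmetric], rule iid.indep_vars_subset[OF indep_vars_iid_seq]) auto
    finally show "char (distr (measure_pmf ?P) borel (\<lambda>x. \<Sum>i\<in>{1..n}. Y (x i))) t =
        char (distr iid_seq borel (\<lambda>\<omega>. \<Sum>i<n. Y (\<omega> i))) t" .
  qed
qed

text \<open>By the central limit theorem the probability of not exceeding the mean tends to 1/2 > q.
  Vanishing variance is treated apart, since the normalisation would divide by zero; there the sum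
  equals its mean almost surely.\<close>

lemma eventually_prob_sum_le_mean:
  fixes Y :: "'a \<Rightarrow> real"
  assumes fin: "finite (set_pmf p)" and q: "q < 1 / 2"
  shows "\<forall>\<^sub>F n in sequentially. q \<le> measure_pmf.prob (Pi_pmf {1..n} dflt (\<lambda>_. p))
           {x. (\<Sum>i\<in>{1..n}. Y (x i)) \<le> real n * measure_pmf.expectation p Y}"
proof (cases "measure_pmf.variance p Y = 0")
  case True
  have const: "AE y in p. Y y = measure_pmf.expectation p Y"
    using True
    by (subst (asm) integral_nonneg_eq_0_iff_AE) (auto simp: integrable_measure_pmf_finite fin)
  have "AE x in Pi_pmf {1..n} dflt (\<lambda>_. p). (\<Sum>i\<in>{1..n}. Y (x i)) \<le> real n * measure_pmf.expectation p Y" for n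
  proof (rule AE_pmfI)
    fix x assume x: "x \<in> set_pmf (Pi_pmf {1..n} dflt (\<lambda>_. p))"
    have "Y (x i) = measure_pmf.expectation p Y" if "i \<in> {1..n}" for i
      using x that const by (auto simp: set_Pi_pmf PiE_dflt_def AE_measure_pmf_iff)
    then show "(\<Sum>i\<in>{1..n}. Y (x i)) \<le> real n * measure_pmf.expectation p Y" by simp
  qed
  then have "measure_pmf.prob (Pi_pmf {1..n} dflt (\<lambda>_. p))
           {x. (\<Sum>i\<in>{1..n}. Y (x i)) \<le> real n * measure_pmf.expectation p Y} = 1" for n
    by (subst measure_pmf.prob_eq_1) simp_all
  then show ?thesis using q by simp
next
  case False
  interpret iid: prob_space iid_seq by (rule prob_space_iid_seq)
  let ?\<mu> = "measure_pmf.expectation p Y"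
  define \<sigma> where "\<sigma> = sqrt (measure_pmf.variance p Y)"
  have "measure_pmf.variance p Y > 0" using False measure_pmf.variance_positive[of p Y] by linarith
  then have \<sigma>: "\<sigma> > 0" "\<sigma>\<^sup>2 = measure_pmf.variance p Y" by (simp_all add: \<sigma>_def)
  have expectation_iid: "iid.expectation (\<lambda>\<omega>. f (\<omega> i)) = measure_pmf.expectation p f"
    for f :: "'a \<Rightarrow> real" and i
    by (subst (2) distr_iid_seq[of i, symmetric], subst integral_distr) auto
  have integrable_iid: "integrable iid_seq (\<lambda>\<omega>. f (\<omega> i))" for f :: "'a \<Rightarrow> real" and i
  proof -
    have "integrable (distr iid_seq (measure_pmf p) (\<lambda>\<omega>. \<omega> i)) f"
      by (subst distr_iid_seq) (simp add: integrable_measure_pmf_finite fin)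
    then show ?thesis by (subst (asm) integrable_distr_eq) auto
  qed
  let ?S = "\<lambda>n \<omega>. (\<Sum>i<n. Y (\<omega> i) - ?\<mu>) / sqrt (real n * \<sigma>\<^sup>2)"
  have "weak_conv_m (\<lambda>n. distr iid_seq borel (?S n)) std_normal_distribution"
  proof (rule iid.central_limit_theorem)
    show "iid.indep_vars (\<lambda>i. borel) (\<lambda>i \<omega>. Y (\<omega> i)) UNIV" by (rule indep_vars_iid_seq)
    show "integrable iid_seq (\<lambda>x. (Y (x n))\<^sup>2)" for n by (rule integrable_iid[of "\<lambda>y. (Y y)\<^sup>2"])
    show "iid.variance (\<lambda>\<omega>. Y (\<omega> n)) = \<sigma>\<^sup>2" for n
      unfolding expectation_iid \<sigma>(2) by (rule expectation_iid[of "\<lambda>y. (Y y - ?\<mu>)\<^sup>2"])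
  qed (simp_all add: \<sigma>(1) expectation_iid distr_iid_seq_borel)
  \<comment> \<open>Weak convergence yields convergence of distribution functions only at continuity
    points of the limit.\<close>
  moreover have "isCont (cdf std_normal_distribution) 0"
  proof -
    interpret N: real_distribution std_normal_distribution by (rule real_dist_normal_dist)
    show ?thesis by (simp add: N.isCont_cdf measure_std_normal_singleton_0)
  qed
  ultimately have "(\<lambda>n. cdf (distr iid_seq borel (?S n)) 0) \<longlonglongrightarrow> cdf std_normal_distribution 0"
    by (simp add: weak_conv_m_def weak_conv_def)
  then have "\<forall>\<^sub>F n in sequentially. q < cdf (distr iid_seq borel (?S n)) 0"
    by (rule order_tendstoD) (use q in \<open>simp add: cdf_def measure_std_normal_atMost_0\<close>)
  then show ?thesis
    using eventually_gt_at_top[of 0]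
  proof eventually_elim
    case (elim n)
    have "cdf (distr iid_seq borel (?S n)) 0 = iid.prob {\<omega>\<in>space iid_seq. ?S n \<omega> \<le> 0}"
      unfolding cdf_def by (subst measure_distr) (auto intro!: arg_cong[where f = iid.prob])
    \<comment> \<open>For n > 0 the normalising factor is positive, so it does not affect the
      sign.\<close>
    also have "{\<omega>\<in>space iid_seq. ?S n \<omega> \<le> 0} = {\<omega>\<in>space iid_seq. (\<Sum>i<n. Y (\<omega> i)) \<le> real n * ?\<mu>}"
      using \<sigma>(1) elim by (auto simp: divide_le_0_iff sum_subtractf mult_le_0_iff)
    also have "iid.prob \<dots> = measure (distr iid_seq borel (\<lambda>\<omega>. \<Sum>i<n. Y (\<omega> i))) {..real n * ?\<mu>}"
      by (subst measure_distr) (auto intro!: arg_cong[where f = iid.prob])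
    also have "\<dots> = measure_pmf.prob (Pi_pmf {1..n} dflt (\<lambda>_. p)) {x. (\<Sum>i\<in>{1..n}. Y (x i)) \<le> real n * ?\<mu>}"
      unfolding distr_Pi_pmf_sum[symmetric, where dflt = dflt]
      by (subst measure_distr) (auto intro!: arg_cong[where f = "measure_pmf.prob _"])
    finally show ?case using elim by simp
  qed
qed

end

subsection \<open>Surprisal of a product distribution\<close>

definition surprisal :: "'a pmf \<Rightarrow> 'a \<Rightarrow> real" where
  "surprisal p a = - log 2 (pmf p a)"

lemma surprisal_nonneg: "a \<in> set_pmf p \<Longrightarrow> surprisal p a \<ge> 0"
  by (simp add: surprisal_def pmf_le_1 pmf_positive)

lemma pmf_eq_powr_surprisal: "a \<in> set_pmf p \<Longrightarrow> pmf p a = 2 powr (- surprisal p a)"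
  by (simp add: surprisal_def pmf_positive)

lemma shannon_entropy_eq_expectation:
  "finite (set_pmf p) \<Longrightarrow> shannon_entropy p = measure_pmf.expectation p (surprisal p)"
  by (subst integral_measure_pmf_real[of "set_pmf p"])
     (auto simp: shannon_entropy_def surprisal_def sum_negf mult.commute)

lemma shannon_entropy_nonneg: "finite (set_pmf p) \<Longrightarrow> shannon_entropy p \<ge> 0"
  unfolding shannon_entropy_eq_expectation
  by (rule integral_nonneg_AE) (simp add: AE_measure_pmf_iff surprisal_nonneg)

lemma set_power_pmfD: "x \<in> set_pmf (power_pmf chi n) \<Longrightarrow> i \<in> {1..n} \<Longrightarrow> x i \<in> set_pmf chi"
  by (auto simp: power_pmf_def set_Pi_pmf PiE_dflt_def)

lemma surprisal_power_pmf:
  assumes x: "x \<in> set_pmf (power_pmf chi n)"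
  shows "surprisal (power_pmf chi n) x = (\<Sum>i\<in>{1..n}. surprisal chi (x i))"
proof -
  have "pmf (power_pmf chi n) x = (\<Prod>i\<in>{1..n}. pmf chi (x i))"
    using x by (auto simp: power_pmf_def set_Pi_pmf PiE_dflt_def pmf_Pi)
  moreover have "pmf chi (x i) \<noteq> 0" if "i \<in> {1..n}" for i
    using set_power_pmfD[OF x that] by (simp add: set_pmf_iff)
  then have "log 2 (\<Prod>i\<in>{1..n}. pmf chi (x i)) = (\<Sum>i\<in>{1..n}. log 2 (pmf chi (x i)))"
    unfolding log_def
    by (subst ln_prod) (auto simp: sum_divide_distrib)
  ultimately show ?thesis by (simp add: surprisal_def sum_negf)
qed

text \<open>The inclusion of events is claimed only almost surely: since \<open>log 2 0 = 0\<close>,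
  letters of probability zero have surprisal 0, and tuples containing them could meet the left
  condition but not the right one.\<close>

lemma prob_surprisal_le:
  "measure_pmf.prob (power_pmf chi n) {x. (\<Sum>i\<in>{1..n}. surprisal chi (x i)) \<le> s}
     \<le> measure_pmf.prob (power_pmf chi n) {x. 1 / 2 powr s \<le> pmf (power_pmf chi n) x}"
proof (rule measure_pmf.finite_measure_mono_AE)
  show "AE x in power_pmf chi n. x \<in> {x. (\<Sum>i\<in>{1..n}. surprisal chi (x i)) \<le> s} \<longrightarrow>
      x \<in> {x. 1 / 2 powr s \<le> pmf (power_pmf chi n) x}"
  proof (rule AE_pmfI, intro impI CollectI)
    fix x assume x: "x \<in> set_pmf (power_pmf chi n)"
      and "x \<in> {x. (\<Sum>i\<in>{1..n}. surprisal chi (x i)) \<le> s}"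
    then have "surprisal (power_pmf chi n) x \<le> s" by (simp add: surprisal_power_pmf)
    then show "1 / 2 powr s \<le> pmf (power_pmf chi n) x"
      unfolding pmf_eq_powr_surprisal[OF x] by (simp flip: powr_minus_divide)
  qed
qed simp

text \<open>Here \<open>s\<close> is the logarithm of the threshold B, so that sqrt B becomes
  2^(s/2).\<close>

lemma prob_power_qmkg_solves_within:
  assumes gk: "is_get_key (power_pmf chi n) get_key"
    and m: "m \<ge> 1" and s: "s \<ge> 0" and cp: "c < p"
    and likely: "p \<le> measure_pmf.prob (power_pmf chi n)
                    {x. (\<Sum>i\<in>{1..n}. surprisal chi (x i)) \<le> s}"
    and T: "20 * 2 powr (s / 2) \<le> T"
  shows "measure_pmf.prob (power_pmf (power_pmf chi n) m)
           {k. qmkg_solves_within (power_pmf chi n) get_key c m T k}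
         \<ge> 1 - exp (- (2 * (p - c)\<^sup>2) * real m)"
proof (rule prob_qmkg_solves_within[where B = "2 powr s"])
  show "1 \<le> 2 powr s" using s by (simp add: ge_one_powr_ge_zero)
  show "20 * sqrt (2 powr s) \<le> T" using T by (simp add: powr_half_sqrt[symmetric] powr_powr)
  show "p \<le> measure_pmf.prob (power_pmf chi n) {x. 1 / 2 powr s \<le> pmf (power_pmf chi n) x}"
    using likely prob_surprisal_le by (rule order_trans)
qed (use assms in auto)

lemma surprisal_bounded:
  assumes "finite (set_pmf chi)"
  obtains b where "b > 0" "\<And>a. a \<in> set_pmf chi \<Longrightarrow> surprisal chi a \<in> {0..b}"
proof
  \<comment> \<open>The summand 1 keeps the bound positive for a point mass, whose surprisal is 0;
    Hoeffding's inequality needs a proper interval.\<close>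
  let ?b = "(\<Sum>a\<in>set_pmf chi. surprisal chi a) + 1"
  have "(\<Sum>a\<in>set_pmf chi. surprisal chi a) \<ge> 0"
    by (intro sum_nonneg surprisal_nonneg)
  then show "?b > 0" by simp
  show "surprisal chi a \<in> {0..?b}" if "a \<in> set_pmf chi" for a
    using member_le_sum[OF that _ assms, of "surprisal chi"] that
    by (auto simp: surprisal_nonneg)
qed

section \<open>Choice of the threshold in the two regimes of c\<close>

theorem theorem4p4:
  fixes chi :: "'a pmf" and c :: real
  assumes "finite (set_pmf chi)" and "0 < c" and "c < 1"
  shows
    "(c < 1 / 2 \<longrightarrow>
       (\<exists>\<gamma>>0. \<exists>C::real. \<exists>d::nat. \<forall>n\<ge>1. \<forall>m\<ge>1. \<forall>get_key.
          is_get_key (power_pmf chi n) get_key \<longrightarrow>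
          measure_pmf.prob (power_pmf (power_pmf chi n) m)
            {k. qmkg_solves_within (power_pmf chi n) get_key c m
                  (C * real n ^ d * 2 powr (shannon_entropy chi * real n / 2)) k}
          \<ge> 1 - exp (- \<gamma> * real m))) \<and>
     (1 / 2 \<le> c \<longrightarrow>
       (\<exists>\<gamma>>0. \<exists>C::real. \<forall>n\<ge>1. \<forall>m\<ge>1. \<forall>get_key.
          is_get_key (power_pmf chi n) get_key \<longrightarrow>
          measure_pmf.prob (power_pmf (power_pmf chi n) m)
            {k. qmkg_solves_within (power_pmf chi n) get_key c m
                  (2 powr (shannon_entropy chi * real n / 2 + C * sqrt (real n))) k}
          \<ge> 1 - exp (- \<gamma> * real m)))"
proof (intro conjI impI)
  note fin = \<open>finite (set_pmf chi)\<close>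
  let ?H = "shannon_entropy chi"
  note H = shannon_entropy_eq_expectation[OF fin] and H0 = shannon_entropy_nonneg[OF fin]
  obtain b where b: "b > 0" "\<And>a. a \<in> set_pmf chi \<Longrightarrow> surprisal chi a \<in> {0..b}"
    using surprisal_bounded[OF fin] by blast
  {
    assume c: "c < 1 / 2"
    \<comment> \<open>The midpoint of c and 1/2: above c for the concentration over keys, below 1/2
      for the central limit theorem.\<close>
    define p where "p = (c + 1 / 2) / 2"
    have p: "c < p" "p < 1 / 2" using c by (auto simp: p_def)
    obtain N where N: "\<And>n. n \<ge> N \<Longrightarrow> p \<le> measure_pmf.prob (power_pmf chi n)
           {x. (\<Sum>i\<in>{1..n}. surprisal chi (x i)) \<le> real n * ?H}"
      using eventually_prob_sum_le_mean[OF fin p(2), of undefined "surprisal chi"]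
      unfolding H power_pmf_def eventually_sequentially by blast
    \<comment> \<open>The 20 is the cost constant; the other factor pays for n < N, where a key's
      surprisal is at most bn \<le> bN.\<close>
    define C where "C = 20 * 2 powr (b * real N / 2)"
    have "measure_pmf.prob (power_pmf (power_pmf chi n) m)
            {k. qmkg_solves_within (power_pmf chi n) get_key c m
                  (C * real n ^ 0 * 2 powr (?H * real n / 2)) k}
          \<ge> 1 - exp (- (2 * (p - c)\<^sup>2) * real m)"
      if m: "m \<ge> 1" and gk: "is_get_key (power_pmf chi n) get_key" for n m get_key
    proof (cases "n \<ge> N")
      case True
      show ?thesis
      proof (rule prob_power_qmkg_solves_within[OF gk m _ p(1) N[OF True]])
        have "1 \<le> 2 powr (b * real N / 2)" using b by (intro ge_one_powr_ge_zero) auto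
        then show "20 * 2 powr (real n * ?H / 2) \<le> C * real n ^ 0 * 2 powr (?H * real n / 2)"
          by (simp add: C_def mult.commute)
      qed (use H0 in simp)
    next
      case False
      \<comment> \<open>The finitely many small \<open>n\<close> are absorbed into the constant \<open>C\<close>.\<close>
      have sum_le: "(\<Sum>i\<in>{1..n}. surprisal chi (x i)) \<le> b * real n"
        if "x \<in> set_pmf (power_pmf chi n)" for x
        using sum_bounded_above[of "{1..n}" "\<lambda>i. surprisal chi (x i)" b] b(2) set_power_pmfD[OF that]
        by (simp add: mult.commute)
      have "measure_pmf.prob (power_pmf chi n)
          {x. (\<Sum>i\<in>{1..n}. surprisal chi (x i)) \<le> b * real n} = 1"
        using sum_le by (subst measure_pmf.prob_eq_1) (simp_all add: AE_measure_pmf_iff)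
      then have likely: "p \<le> measure_pmf.prob (power_pmf chi n)
          {x. (\<Sum>i\<in>{1..n}. surprisal chi (x i)) \<le> b * real n}"
        using p by simp
      show ?thesis
      proof (rule prob_power_qmkg_solves_within[OF gk m _ p(1) likely])
        have "2 powr (b * real n / 2) \<le> 2 powr (b * real N / 2)" using False b by simp
        moreover have "1 \<le> 2 powr (?H * real n / 2)" using H0 by (intro ge_one_powr_ge_zero) auto
        ultimately have "2 powr (b * real n / 2) * 1 \<le> 2 powr (b * real N / 2) * 2 powr (?H * real n / 2)"
          by (intro mult_mono) auto
        then show "20 * 2 powr (b * real n / 2) \<le> C * real n ^ 0 * 2 powr (?H * real n / 2)"
          by (simp add: C_def)
      qed (use b in simp)
    qed
    then show "\<exists>\<gamma>>0. \<exists>C::real. \<exists>d::nat. \<forall>n\<ge>1. \<forall>m\<ge>1. \<forall>get_key.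
          is_get_key (power_pmf chi n) get_key \<longrightarrow>
          measure_pmf.prob (power_pmf (power_pmf chi n) m)
            {k. qmkg_solves_within (power_pmf chi n) get_key c m
                  (C * real n ^ d * 2 powr (?H * real n / 2)) k}
          \<ge> 1 - exp (- \<gamma> * real m)"
      \<comment> \<open>The rate depends on c alone, as p - c = (1/2 - c)/2. The polynomial factor
        has degree 0.\<close>
      using p by (intro exI[of _ "2 * (p - c)\<^sup>2"] exI[of _ C] exI[of _ 0] conjI allI impI) auto
  }
  {
    define p where "p = (1 + c) / 2"
    have p: "c < p" "p < 1" using \<open>c < 1\<close> by (auto simp: p_def field_simps)
    \<comment> \<open>Solves exp(-2 a^2 / b^2) = 1 - p, so that a deviation of a sqrt n has
      Hoeffding bound exactly 1 - p.\<close>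
    define a where "a = b * sqrt (ln (1 / (1 - p)) / 2)"
    have ln0: "ln (1 / (1 - p)) \<ge> 0" using p \<open>0 < c\<close> by (intro ln_ge_zero) simp
    then have a: "a \<ge> 0" "2 * a\<^sup>2 / b\<^sup>2 = ln (1 / (1 - p))"
      using b by (auto simp: a_def power_mult_distrib)
    \<comment> \<open>The square root of B halves \<open>a\<close>, and the constant 20 \<le> 2^5 is
      absorbed through 5 \<le> 5 sqrt n.\<close>
    define C where "C = a / 2 + 5"
    have "measure_pmf.prob (power_pmf (power_pmf chi n) m)
            {k. qmkg_solves_within (power_pmf chi n) get_key c m
                  (2 powr (?H * real n / 2 + C * sqrt (real n))) k}
          \<ge> 1 - exp (- (2 * (p - c)\<^sup>2) * real m)"
      if n: "n \<ge> 1" and m: "m \<ge> 1" and gk: "is_get_key (power_pmf chi n) get_key" for n m get_key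
    proof -
      let ?s = "real n * ?H + a * sqrt (real n)"
      let ?P = "power_pmf chi n"
      have "measure_pmf.prob ?P {x. (\<Sum>i\<in>{1..n}. surprisal chi (x i)) \<ge> ?s}
          \<le> exp (- 2 * (a * sqrt (real n))\<^sup>2 / (real n * b\<^sup>2))"
        using Pi_pmf_sum_tail(1)[of "{1..n}" 0 b chi "surprisal chi" "a * sqrt (real n)" undefined]
          n a b by (simp add: power_pmf_def H)
      also have "- 2 * (a * sqrt (real n))\<^sup>2 / (real n * b\<^sup>2) = - (2 * a\<^sup>2 / b\<^sup>2)"
        using n b by (simp add: power_mult_distrib field_simps)
      also have "exp \<dots> = 1 - p" unfolding a(2) using p by (simp add: ln_div)
      finally have "p \<le> measure_pmf.prob ?P (UNIV - {x. (\<Sum>i\<in>{1..n}. surprisal chi (x i)) \<ge> ?s})"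
        using measure_pmf.prob_compl[of "{x. (\<Sum>i\<in>{1..n}. surprisal chi (x i)) \<ge> ?s}" ?P] by simp
      also have "\<dots> \<le> measure_pmf.prob ?P {x. (\<Sum>i\<in>{1..n}. surprisal chi (x i)) \<le> ?s}"
        by (intro measure_pmf.finite_measure_mono) auto
      finally have likely: "p \<le> \<dots>" .
      show ?thesis
      proof (rule prob_power_qmkg_solves_within[OF gk m _ p(1) likely])
        have "20 * 2 powr (?s / 2) \<le> 2 powr 5 * 2 powr (?s / 2)" by simp
        also have "\<dots> = 2 powr (5 + ?s / 2)" by (simp add: powr_add)
        also have "\<dots> \<le> 2 powr (?H * real n / 2 + C * sqrt (real n))"
          using n by (simp add: C_def algebra_simps add_divide_distrib)
        finally show "20 * 2 powr (?s / 2) \<le> 2 powr (?H * real n / 2 + C * sqrt (real n))" .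
      qed (use H0 a in simp)
    qed
    then show "\<exists>\<gamma>>0. \<exists>C::real. \<forall>n\<ge>1. \<forall>m\<ge>1. \<forall>get_key.
          is_get_key (power_pmf chi n) get_key \<longrightarrow>
          measure_pmf.prob (power_pmf (power_pmf chi n) m)
            {k. qmkg_solves_within (power_pmf chi n) get_key c m
                  (2 powr (?H * real n / 2 + C * sqrt (real n))) k}
          \<ge> 1 - exp (- \<gamma> * real m)"
      using p by (intro exI[of _ "2 * (p - c)\<^sup>2"] exI[of _ C] conjI allI impI) auto
  }
qed

end
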